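(* There exist absolute constants $C_1,C_2>0$ such that the following holds. Let $f\colon\mathbb R\to\mathbb R$ be twice differentiable with $f''\ge\alpha_0$ for some constant $\alpha_0>0$, let $u_\ell\geq u_r$ and $u_-,u_+\in\mathbb R$, and let $0<\alpha\leq M$ be such that $\alpha\leq f''\leq M$ on the convex hull of $\{u_-,u_+,u_\ell,u_r\}$. Then $$D(u_-,u_+;u_\ell,u_r)\leq C_1\frac{M^3}{\alpha^3}\max(E(u_-,u_+),0)-C_2\,\alpha\,(u_\ell-u_r)\left[(u_\ell-u_-)^2+(u_r-u_+)^2\right].$$
   Context: Notation: $\eta(x)=\frac{x^2}{2}$, $q(x)=\int_0^x\eta'(s)f'(s)\,ds=\int_0^x s f'(s)\,ds$; relative entropy and flux $$\eta(x|a)=\eta(x)-\eta(a)-\eta'(a)(x-a)=\frac{(x-a)^2}{2},\qquad q(x;a)=q(x)-q(a)-\eta'(a)(f(x)-f(a)).$$ Shock speed: $\sigma(u_-,u_+)=\frac{f(u_+)-f(u_-)}{u_+-u_-}$ if $u_-\neq u_+$, and $\sigma(u,u)=f'(u)$. Dissipation rate: $$D(u_-,u_+;u_\ell,u_r)=q(u_+;u_r)-q(u_-;u_\ell)-\sigma(u_-,u_+)\left(\eta(u_+|u_r)-\eta(u_-|u_\ell)\right).$$ Entropy cost of the jump $(u_-,u_+)$: $$E(u_-,u_+)=q(u_+)-q(u_-)-\sigma(u_-,u_+)\left(\eta(u_+)-\eta(u_-)\right).$$ *)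

theory Defs
  imports "HOL-Analysis.Analysis"
begin

definition eta :: "real \<Rightarrow> real" where
  "eta x = x\<^sup>2 / 2"

(* The interval integral is oriented, so this is also the intended value for x < 0. *)
definition entropy_flux :: "(real \<Rightarrow> real) \<Rightarrow> real \<Rightarrow> real" where
  "entropy_flux f x = (LBINT s=0..x. deriv eta s * deriv f s)"

definition rel_eta :: "real \<Rightarrow> real \<Rightarrow> real" where
  "rel_eta x a = eta x - eta a - deriv eta a * (x - a)"

definition rel_flux :: "(real \<Rightarrow> real) \<Rightarrow> real \<Rightarrow> real \<Rightarrow> real" where
  "rel_flux f x a = entropy_flux f x - entropy_flux f a - deriv eta a * (f x - f a)"

definition shock_speed :: "(real \<Rightarrow> real) \<Rightarrow> real \<Rightarrow> real \<Rightarrow> real" where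
  "shock_speed f um up = (if um = up then deriv f um else (f up - f um) / (up - um))"

definition dissipation_rate ::
    "(real \<Rightarrow> real) \<Rightarrow> real \<Rightarrow> real \<Rightarrow> real \<Rightarrow> real \<Rightarrow> real" where
  "dissipation_rate f um up ul ur =
     rel_flux f up ur - rel_flux f um ul
       - shock_speed f um up * (rel_eta up ur - rel_eta um ul)"

definition entropy_cost :: "(real \<Rightarrow> real) \<Rightarrow> real \<Rightarrow> real \<Rightarrow> real" where
  "entropy_cost f um up =
     entropy_flux f up - entropy_flux f um - shock_speed f um up * (eta up - eta um)"

lemma deriv_eta [simp]: "deriv eta = (\<lambda>x. x)"
proof
  fix x :: real
  have "((\<lambda>x. x\<^sup>2 / 2) has_field_derivative x) (at x)"
    by (auto intro!: derivative_eq_intros)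
  then have "(eta has_field_derivative x) (at x)"
    by (simp add: eta_def[abs_def])
  then show "deriv eta x = x"
    by (rule DERIV_imp_deriv)
qed

lemma entropy_flux_eq: "entropy_flux f x = (LBINT s=0..x. s * deriv f s)"
  by (simp add: entropy_flux_def)

lemma rel_eta_eq: "rel_eta x a = (x - a)\<^sup>2 / 2"
  by (simp add: rel_eta_def eta_def power2_eq_square field_simps)

end

theory Submission
  imports Defs
begin

text \<open>
  Write \<open>\<sigma>\<close> for the shock speed and \<open>g s = f s - f um - \<sigma> * (s - um)\<close> for the gap between \<open>f\<close> and
  its chord (its tangent, if \<open>um = up\<close>) through the two states of the jump. Subtracting an affine
  function from the flux changes neither side of the inequality, and reduces it to a jump of speed
  zero with a flux that vanishes at both states. Integrating by parts then turns the entropy cost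
  into \<open>E = - (\<integral> g from um to up)\<close> and the dissipation rate into
  \<open>D = E - (\<integral> g from ur to ul)\<close> (lemmas \<open>entropy_cost_eq\<close> and \<open>dissipation_rate_eq\<close>).

  So only lower bounds for \<open>\<integral> g\<close> over an interval are needed. Compare \<open>g\<close> with
  the parabola \<open>p s = \<alpha> / 2 * (s - um) * (s - up)\<close>, which is the gap of the flux
  \<open>\<alpha> / 2 * s\<^sup>2\<close>. The difference \<open>g - p\<close> is convex on the hull of the four states and vanishes at
  \<open>um\<close> and \<open>up\<close>, so it is nonpositive between them and nonnegative elsewhere
  (\<open>convex_sign_between\<close>, \<open>convex_sign_outside\<close>). Hence among all intervals in the hull, the
  one between \<open>um\<close> and \<open>up\<close> has the least integral of \<open>g - p\<close> (\<open>least_increment_between_zeros\<close>).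
  With \<open>ur \<le> ul\<close> this compares \<open>\<integral> g\<close> over \<open>{ur..ul}\<close> with explicit cubic polynomials.

  If \<open>up \<le> um\<close> (an entropic shock), the comparison bounds \<open>D\<close> by its value for the quadratic flux,
  and a polynomial inequality finishes. If \<open>um < up\<close>, the comparison costs an additional
  multiple of \<open>E\<close>, but \<open>E\<close> is then at least \<open>\<alpha> / 12 * (up - um) ^ 3\<close>, and this cubic amount
  pays for the part of the parabola below zero. Both cases give an absolute constant in front
  of \<open>E\<close>, which suffices because \<open>M ^ 3 / \<alpha> ^ 3 \<ge> 1\<close>.
\<close>

section \<open>Entropy cost and dissipation through the gap to the chord\<close>

lemma has_field_derivative_entropy_flux:
  assumes "\<And>x. deriv f differentiable (at x)"
  shows "(entropy_flux f has_field_derivative x * deriv f x) (at x)"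
proof -
  have cont: "continuous_on A (\<lambda>s. s * deriv f s)" for A
    using assms differentiable_imp_continuous_within
    by (intro continuous_intros continuous_at_imp_continuous_on) blast
  define A where "A = min 0 x - 1"
  define B where "B = max 0 x + 1"
  have AB: "A < 0" "A < x" "0 < B" "x < B"
    by (auto simp: A_def B_def)
  have "((\<lambda>u. LBINT s=ereal 0..ereal u. s * deriv f s) has_vector_derivative x * deriv f x)
      (at x within {A..B})"
    using AB cont by (intro interval_integral_FTC2) auto
  moreover have "at x within {A..B} = at x"
    using AB by (intro at_within_interior) auto
  moreover have "entropy_flux f = (\<lambda>u. LBINT s=ereal 0..ereal u. s * deriv f s)"
    by (auto simp: entropy_flux_eq zero_ereal_def)
  ultimately show ?thesis
    by (simp add: has_real_derivative_iff_has_vector_derivative)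
qed

text \<open>
  By parts, \<open>s * f s - entropy_flux f s\<close> is an antiderivative of \<open>f\<close>; the other terms
  subtract the affine part, so that the value below is an antiderivative of the gap between \<open>f\<close>
  and its chord.
\<close>

definition gap_primitive :: "(real \<Rightarrow> real) \<Rightarrow> real \<Rightarrow> real \<Rightarrow> real \<Rightarrow> real" where
  "gap_primitive f u v s =
     s * f s - entropy_flux f s - f u * s - shock_speed f u v * (s - u)\<^sup>2 / 2"

lemma has_field_derivative_gap_primitive:
  assumes "f differentiable (at s)" and "\<And>x. deriv f differentiable (at x)"
  shows "(gap_primitive f u v has_field_derivative f s - f u - shock_speed f u v * (s - u)) (at s)"
proof -
  have f: "(f has_field_derivative deriv f s) (at s)"
    using assms(1) by (simp add: DERIV_deriv_iff_real_differentiable)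
  show ?thesis
    unfolding gap_primitive_def[abs_def]
    by (auto intro!: derivative_eq_intros f has_field_derivative_entropy_flux assms(2))
qed

lemma rankine_hugoniot: "shock_speed f u v * (v - u) = f v - f u"
  by (simp add: shock_speed_def)

lemma entropy_cost_eq: "entropy_cost f u v = gap_primitive f u v u - gap_primitive f u v v"
proof -
  have fv: "f v = f u + shock_speed f u v * (v - u)"
    by (simp add: rankine_hugoniot)
  show ?thesis
    unfolding entropy_cost_def gap_primitive_def eta_def fv
    by (simp add: field_simps power2_eq_square)
qed

lemma dissipation_rate_eq:
  "dissipation_rate f u v a b =
     entropy_cost f u v - (gap_primitive f u v a - gap_primitive f u v b)"
proof -
  have fv: "f v = f u + shock_speed f u v * (v - u)"
    by (simp add: rankine_hugoniot)
  show ?thesis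
    unfolding dissipation_rate_def rel_flux_def rel_eta_eq entropy_cost_def gap_primitive_def
      eta_def deriv_eta fv
    by (simp add: field_simps power2_eq_square)
qed

section \<open>Sign of a convex function with two zeros\<close>

text \<open>
  Convexity enters through the tangent inequality only. This form needs no interior points, and it
  treats a double zero (\<open>lo = hi\<close> with vanishing slope) like two distinct ones. The tangent at \<open>s\<close>
  lies below both zeros; as \<open>lo - s\<close> and \<open>hi - s\<close> have opposite signs, its slope pushes the value
  at \<open>s\<close> below zero from one of the two sides.
\<close>

lemma convex_sign_between:
  fixes r r' :: "real \<Rightarrow> real"
  assumes tangent: "\<And>x y. x \<in> K \<Longrightarrow> y \<in> K \<Longrightarrow> r' x * (y - x) \<le> r y - r x"
    and K: "lo \<in> K" "hi \<in> K" "s \<in> K" and "r lo = 0" "r hi = 0" and "lo \<le> s" "s \<le> hi"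
  shows "r s \<le> 0"
proof (cases "r' s \<ge> 0")
  case True
  then have "0 \<le> r' s * (hi - s)"
    using assms by simp
  then show ?thesis
    using tangent[of s hi] assms by simp
next
  case False
  then have "0 \<le> r' s * (lo - s)"
    using assms by (simp add: mult_nonpos_nonpos)
  then show ?thesis
    using tangent[of s lo] assms by simp
qed

text \<open>
  The tangent at \<open>hi\<close> lies below the zero at \<open>lo\<close>, so it increases, and it stays below the
  function to the right of \<open>hi\<close>; likewise on the left. At a double zero the tangent is horizontal.
\<close>

lemma convex_sign_outside:
  fixes r r' :: "real \<Rightarrow> real"
  assumes tangent: "\<And>x y. x \<in> K \<Longrightarrow> y \<in> K \<Longrightarrow> r' x * (y - x) \<le> r y - r x"
    and K: "lo \<in> K" "hi \<in> K" "s \<in> K" and zero: "r lo = 0" "r hi = 0"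
    and "lo \<le> hi" and double: "lo = hi \<Longrightarrow> r' lo = 0" and out: "s \<le> lo \<or> hi \<le> s"
  shows "r s \<ge> 0"
proof -
  have slopes: "r' lo \<le> 0 \<and> 0 \<le> r' hi"
  proof (cases "lo = hi")
    case False
    then have "lo < hi"
      using assms by simp
    moreover have "r' lo * (hi - lo) \<le> 0" "r' hi * (lo - hi) \<le> 0"
      using tangent[of lo hi] tangent[of hi lo] K zero by auto
    ultimately show ?thesis
      by (auto simp: mult_le_0_iff)
  qed (use double in auto)
  from out show ?thesis
  proof
    assume "s \<le> lo"
    then have "0 \<le> r' lo * (s - lo)"
      using slopes by (simp add: mult_nonpos_nonpos)
    then show ?thesis
      using tangent[of lo s] K zero by simp
  next
    assume "hi \<le> s"
    then have "0 \<le> r' hi * (s - hi)"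
      using slopes by simp
    then show ?thesis
      using tangent[of hi s] K zero by simp
  qed
qed

text \<open>
  The integral of \<open>r\<close> over \<open>{b..a}\<close> is least for \<open>{lo..hi}\<close>, which collects all negative values
  and no positive ones. In terms of the antiderivative \<open>R\<close>: it rises up to \<open>lo\<close>, falls up to \<open>hi\<close>
  and rises again, so \<open>hi\<close> minimizes it to the right of \<open>lo\<close> and \<open>lo\<close> maximizes it to the left of
  \<open>hi\<close>.
\<close>

lemma least_increment_between_zeros:
  fixes R r :: "real \<Rightarrow> real"
  assumes "is_interval K" and K: "lo \<in> K" "hi \<in> K" "a \<in> K" "b \<in> K" and "lo \<le> hi" "b \<le> a"
    and R: "\<And>x. (R has_field_derivative r x) (at x)"
    and between: "\<And>x. x \<in> K \<Longrightarrow> lo \<le> x \<Longrightarrow> x \<le> hi \<Longrightarrow> r x \<le> 0"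
    and outside: "\<And>x. x \<in> K \<Longrightarrow> x \<le> lo \<or> hi \<le> x \<Longrightarrow> r x \<ge> 0"
  shows "R hi - R lo \<le> R a - R b"
proof -
  have rise: "R x \<le> R y" if "x \<in> K" "y \<in> K" "x \<le> y" "y \<le> lo \<or> hi \<le> x" for x y
  proof (rule DERIV_nonneg_imp_nondecreasing[OF \<open>x \<le> y\<close>])
    fix z assume z: "x \<le> z" "z \<le> y"
    then have "z \<in> K"
      using mem_is_interval_1_I[OF \<open>is_interval K\<close>] that by blast
    then have "r z \<ge> 0"
      using outside z that by fastforce
    then show "\<exists>d. (R has_field_derivative d) (at z) \<and> 0 \<le> d"
      using R by blast
  qed
  have fall: "R y \<le> R x" if "x \<in> K" "y \<in> K" "x \<le> y" "lo \<le> x" "y \<le> hi" for x y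
  proof (rule DERIV_nonpos_imp_nonincreasing[OF \<open>x \<le> y\<close>])
    fix z assume z: "x \<le> z" "z \<le> y"
    then have "z \<in> K"
      using mem_is_interval_1_I[OF \<open>is_interval K\<close>] that by blast
    then have "r z \<le> 0"
      using between z that by fastforce
    then show "\<exists>d. (R has_field_derivative d) (at z) \<and> d \<le> 0"
      using R by blast
  qed
  have fall_all: "R hi \<le> R lo"
    using fall K \<open>lo \<le> hi\<close> by blast
  consider "a \<le> lo" | "hi \<le> b" | "lo \<le> a" "b \<le> hi"
    by linarith
  then show ?thesis
  proof cases
    case 1
    then show ?thesis
      using rise[of b a] fall_all K \<open>b \<le> a\<close> by simp
  next
    case 2
    then show ?thesis
      using rise[of b a] fall_all K \<open>b \<le> a\<close> by simp
  next
    case 3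
    have "R hi \<le> R a"
      using rise[of hi a] fall[of a hi] K 3 by linarith
    moreover have "R b \<le> R lo"
      using rise[of b lo] fall[of lo b] K 3 by linarith
    ultimately show ?thesis
      by simp
  qed
qed

section \<open>Comparison with the quadratic flux\<close>

text \<open>An antiderivative of \<open>\<alpha> / 2 * (s - u) * (s - v)\<close>.\<close>

definition parabola_primitive :: "real \<Rightarrow> real \<Rightarrow> real \<Rightarrow> real \<Rightarrow> real" where
  "parabola_primitive \<alpha> u v s = \<alpha> / 2 * (s ^ 3 / 3 - (u + v) * s\<^sup>2 / 2 + u * v * s)"

lemma has_field_derivative_parabola_primitive:
  "(parabola_primitive \<alpha> u v has_field_derivative \<alpha> / 2 * ((s - u) * (s - v))) (at s)"
  unfolding parabola_primitive_def[abs_def]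
  by (auto intro!: derivative_eq_intros) (simp add: field_simps power2_eq_square)

lemma parabola_primitive_zeros:
  "parabola_primitive \<alpha> u v v - parabola_primitive \<alpha> u v u = - (\<alpha> / 12 * (v - u) ^ 3)"
  by (simp add: parabola_primitive_def field_simps power2_eq_square power3_eq_cube)

text \<open>
  The gap minus the parabola has second derivative \<open>f'' - \<alpha> \<ge> 0\<close> and vanishes at \<open>u\<close> and \<open>v\<close>. For
  \<open>u = v\<close> the zero is double, because the shock speed is then the slope of \<open>f\<close>; so the jump
  of size zero is no exception.
\<close>

lemma gap_increment_ge:
  fixes f :: "real \<Rightarrow> real"
  assumes f: "\<And>x. f differentiable (at x)" and f': "\<And>x. deriv f differentiable (at x)"
    and K: "is_interval K" "u \<in> K" "v \<in> K" "a \<in> K" "b \<in> K"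
    and curvature: "\<And>x. x \<in> K \<Longrightarrow> \<alpha> \<le> deriv (deriv f) x"
    and "b \<le> a" and ends: "lo = min u v" "hi = max u v"
  shows "gap_primitive f u v hi - gap_primitive f u v lo
         - (parabola_primitive \<alpha> u v hi - parabola_primitive \<alpha> u v lo)
      \<le> gap_primitive f u v a - gap_primitive f u v b
         - (parabola_primitive \<alpha> u v a - parabola_primitive \<alpha> u v b)"
proof -
  define \<sigma> where "\<sigma> = shock_speed f u v"
  define r where "r s = f s - f u - \<sigma> * (s - u) - \<alpha> / 2 * ((s - u) * (s - v))" for s
  define r' where "r' s = deriv f s - \<sigma> - \<alpha> / 2 * (2 * s - u - v)" for s
  have f_deriv: "(f has_field_derivative deriv f s) (at s)" for s
    using f by (simp add: DERIV_deriv_iff_real_differentiable)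
  have f'_deriv: "(deriv f has_field_derivative deriv (deriv f) s) (at s)" for s
    using f' by (simp add: DERIV_deriv_iff_real_differentiable)
  have r_deriv: "(r has_field_derivative r' s) (at s)" for s
    unfolding r_def[abs_def] r'_def
    by (auto intro!: derivative_eq_intros f_deriv simp: algebra_simps)
  have r'_deriv: "(r' has_field_derivative deriv (deriv f) s - \<alpha>) (at s)" for s
    unfolding r'_def[abs_def]
    by (auto intro!: derivative_eq_intros f'_deriv)
  have tangent: "r' x * (y - x) \<le> r y - r x" if "x \<in> K" "y \<in> K" for x y
    using K curvature that
    by (intro f''_imp_f'[where C = K and f'' = "\<lambda>s. deriv (deriv f) s - \<alpha>"] r_deriv r'_deriv)
      (auto simp: is_interval_convex_1)
  have "r u = 0" "r v = 0"
    using rankine_hugoniot[of f u v] by (auto simp: r_def \<sigma>_def)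
  then have zeros: "r lo = 0" "r hi = 0"
    by (auto simp: ends min_def max_def)
  have double: "r' lo = 0" if "lo = hi"
  proof -
    have "v = u"
      using that by (auto simp: ends min_def max_def split: if_splits)
    then show ?thesis
      by (simp add: ends r'_def \<sigma>_def shock_speed_def)
  qed
  have K': "lo \<in> K" "hi \<in> K" "lo \<le> hi"
    using K by (auto simp: ends min_def max_def)
  define R where "R s = gap_primitive f u v s - parabola_primitive \<alpha> u v s" for s
  have "R hi - R lo \<le> R a - R b"
  proof (rule least_increment_between_zeros[where R = R and r = r and K = K])
    show "(R has_field_derivative r x) (at x)" for x
      unfolding R_def[abs_def] r_def \<sigma>_def
      by (intro DERIV_diff has_field_derivative_gap_primitive has_field_derivative_parabola_primitive
          f f')
    show "r x \<le> 0" if "x \<in> K" "lo \<le> x" "x \<le> hi" for x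
      using convex_sign_between[of K r' r lo hi x] tangent K' zeros that by blast
    show "0 \<le> r x" if "x \<in> K" "x \<le> lo \<or> hi \<le> x" for x
      using convex_sign_outside[of K r' r lo hi x] tangent K' zeros double that by blast
  qed (use K K' \<open>b \<le> a\<close> in auto)
  then show ?thesis
    by (simp add: R_def)
qed

section \<open>The two polynomial inequalities\<close>

text \<open>
  The left-hand side is, up to the factor \<open>\<alpha>\<close>, minus the dissipation rate of an entropic shock of
  the quadratic flux. Pass to the half widths \<open>h\<close>, \<open>k\<close> of \<open>{v..u}\<close>, \<open>{b..a}\<close> and
  the distance \<open>d\<close> of their midpoints: since \<open>k ^ 3 - 3 * k * h\<^sup>2 + 2 * h ^ 3\<close> has the double root
  \<open>k = h\<close>, the difference of the sides is a sum of squares with nonnegative weights.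
\<close>

lemma cubic_ineq_entropic:
  fixes u v a b :: real
  assumes "v \<le> u" "b \<le> a"
  shows "parabola_primitive 1 u v a - parabola_primitive 1 u v b + (u - v) ^ 3 / 12
    \<ge> (a - b) * ((a - u)\<^sup>2 + (b - v)\<^sup>2) / 48"
proof -
  define h where "h = (u - v) / 2"
  define k where "k = (a - b) / 2"
  define d where "d = (a + b) / 2 - (u + v) / 2"
  have pos: "h \<ge> 0" "k \<ge> 0"
    using assms by (auto simp: h_def k_def)
  have "parabola_primitive 1 u v a - parabola_primitive 1 u v b + (u - v) ^ 3 / 12
      - (a - b) * ((a - u)\<^sup>2 + (b - v)\<^sup>2) / 48
    = 11 / 12 * k * d\<^sup>2 + (k - h)\<^sup>2 * (k / 4 + 2 / 3 * h)"
    unfolding parabola_primitive_def h_def k_def d_def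
    by (simp add: field_simps power2_eq_square power3_eq_cube)
  also have "\<dots> \<ge> 0"
    using pos by simp
  finally show ?thesis
    by simp
qed

text \<open>
  In the same variables, now with \<open>h\<close> the half width of \<open>{u..v}\<close>, the integral of the parabola
  contains the negative term \<open>- k * h\<^sup>2\<close>. Young's inequality absorbs it into \<open>k ^ 3\<close> and a multiple
  of \<open>h ^ 3\<close>, that is, of \<open>(v - u) ^ 3\<close>. The factor \<open>1 / 48\<close> is small enough that the square
  \<open>(k + h)\<^sup>2 \<le> 2 * k\<^sup>2 + 2 * h\<^sup>2\<close> coming from the right-hand side consumes only half of the
  available \<open>k ^ 3 / 3\<close>. The inequality used is
  \<open>7 * k * h\<^sup>2 \<le> k ^ 3 + 8 * h ^ 3\<close>; as \<open>k ^ 3 - 3 * t\<^sup>2 * k * h\<^sup>2 + 2 * t ^ 3 * h ^ 3\<close>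
  has the double root \<open>k = t * h\<close>, any \<open>t\<close> with \<open>3 * t\<^sup>2 \<ge> 7\<close> and \<open>t ^ 3 \<le> 4\<close> proves it, for instance
  \<open>t = 11 / 7\<close>.
\<close>

lemma cubic_ineq_non_entropic:
  fixes u v a b :: real
  assumes "u \<le> v" "b \<le> a"
  shows "parabola_primitive 1 u v a - parabola_primitive 1 u v b + (v - u) ^ 3 / 6
    \<ge> (a - b) * ((a - u)\<^sup>2 + (b - v)\<^sup>2) / 48"
proof -
  define h where "h = (v - u) / 2"
  define k where "k = (a - b) / 2"
  define d where "d = (a + b) / 2 - (u + v) / 2"
  have pos: "h \<ge> 0" "k \<ge> 0"
    using assms by (auto simp: h_def k_def)
  have young: "k ^ 3 - 7 * k * h\<^sup>2 + 8 * h ^ 3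
      = (k - 11 / 7 * h)\<^sup>2 * (k + 22 / 7 * h) + h\<^sup>2 * (20 / 49 * k + 82 / 343 * h)"
    by (simp add: field_simps power2_eq_square power3_eq_cube)
  have "parabola_primitive 1 u v a - parabola_primitive 1 u v b + (v - u) ^ 3 / 6
      - (a - b) * ((a - u)\<^sup>2 + (b - v)\<^sup>2) / 48
    = 11 / 12 * k * d\<^sup>2 + k * (k - h)\<^sup>2 / 12 + (k ^ 3 - 7 * k * h\<^sup>2 + 8 * h ^ 3) / 6"
    unfolding parabola_primitive_def h_def k_def d_def
    by (simp add: field_simps power2_eq_square power3_eq_cube)
  also have "\<dots> \<ge> 0"
    unfolding young using pos by simp
  finally show ?thesis
    by simp
qed

section \<open>The dissipation estimate\<close>

lemma dissipation_rate_le: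
  fixes f :: "real \<Rightarrow> real"
  assumes f: "\<And>x. f differentiable (at x)" and f': "\<And>x. deriv f differentiable (at x)"
    and K: "is_interval K" "um \<in> K" "up \<in> K" "ul \<in> K" "ur \<in> K"
    and curvature: "\<And>x. x \<in> K \<Longrightarrow> \<alpha> \<le> deriv (deriv f) x"
    and "\<alpha> > 0" "ur \<le> ul"
  shows "dissipation_rate f um up ul ur
    \<le> 3 * max (entropy_cost f um up) 0
      - 1 / 48 * \<alpha> * (ul - ur) * ((ul - um)\<^sup>2 + (ur - up)\<^sup>2)"
proof -
  define G where "G = gap_primitive f um up"
  define P where "P = parabola_primitive \<alpha> um up"
  define E where "E = entropy_cost f um up"
  define T where "T = (ul - ur) * ((ul - um)\<^sup>2 + (ur - up)\<^sup>2) / 48"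
  have E: "E = G um - G up"
    by (simp add: E_def G_def entropy_cost_eq)
  have D: "dissipation_rate f um up ul ur = E - (G ul - G ur)"
    by (simp add: E_def G_def dissipation_rate_eq)
  have P_scale: "P ul - P ur
      = \<alpha> * (parabola_primitive 1 um up ul - parabola_primitive 1 um up ur)"
    by (simp add: P_def parabola_primitive_def algebra_simps)
  have P_jump: "P up - P um = - (\<alpha> / 12 * (up - um) ^ 3)"
    unfolding P_def by (rule parabola_primitive_zeros)
  have compare: "G (max um up) - G (min um up) - (P (max um up) - P (min um up))
      \<le> G a - G b - (P a - P b)" if "a \<in> K" "b \<in> K" "b \<le> a" for a b
    unfolding G_def P_def using gap_increment_ge[OF f f'] K curvature that by blast
  note main = compare[of ul ur, OF K(4) K(5) \<open>ur \<le> ul\<close>]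
  have "E - (G ul - G ur) \<le> 3 * max E 0 - \<alpha> * T"
  proof (cases "up \<le> um")
    case True
    have "\<alpha> * T \<le> \<alpha> * (parabola_primitive 1 um up ul - parabola_primitive 1 um up ur
        + (um - up) ^ 3 / 12)"
      unfolding T_def using cubic_ineq_entropic[OF True \<open>ur \<le> ul\<close>] \<open>\<alpha> > 0\<close> by simp
    also have "\<dots> = P ul - P ur - (P um - P up)"
      using P_scale power_minus_odd[of 3 "up - um"] P_jump by (simp add: algebra_simps)
    also have "\<dots> \<le> G ul - G ur - E"
      using main True by (simp add: E max_def min_def split: if_splits)
    finally show ?thesis
      by simp
  next
    case False
    then have "um \<le> up"
      by simp
    then have ends: "max um up = up" "min um up = um"
      by auto
    \<comment> \<open>A degenerate interval has zero increment, so the comparison yields the lower bound of the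
      entropy cost.\<close>
    have cost: "\<alpha> / 12 * (up - um) ^ 3 \<le> E"
      using compare[of um um] K P_jump by (simp add: ends E)
    have "0 \<le> \<alpha> / 12 * (up - um) ^ 3"
      using \<open>um \<le> up\<close> \<open>\<alpha> > 0\<close> by simp
    with cost have "E \<ge> 0"
      by linarith
    have "\<alpha> * T \<le> \<alpha> * (parabola_primitive 1 um up ul - parabola_primitive 1 um up ur
        + (up - um) ^ 3 / 6)"
      unfolding T_def using cubic_ineq_non_entropic[OF \<open>um \<le> up\<close> \<open>ur \<le> ul\<close>] \<open>\<alpha> > 0\<close> by simp
    also have "\<dots> = P ul - P ur - (P up - P um) + \<alpha> / 12 * (up - um) ^ 3"
      using P_jump P_scale by (simp add: algebra_simps)
    also have "\<dots> \<le> G ul - G ur + E + E"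
      using main cost by (simp add: E ends)
    finally show ?thesis
      using \<open>E \<ge> 0\<close> by simp
  qed
  then show ?thesis
    unfolding D by (simp add: E_def T_def)
qed

theorem proposition2p1:
  shows "\<exists>C1 C2 :: real. C1 > 0 \<and> C2 > 0 \<and>
    (\<forall>(f :: real \<Rightarrow> real) (\<alpha>\<^sub>0 :: real) (ul :: real) (ur :: real) (um :: real) (up :: real)
        (\<alpha> :: real) (M :: real).
      (\<forall>x. f differentiable (at x)) \<longrightarrow>
      (\<forall>x. deriv f differentiable (at x)) \<longrightarrow>
      \<alpha>\<^sub>0 > 0 \<longrightarrow>
      (\<forall>x. deriv (deriv f) x \<ge> \<alpha>\<^sub>0) \<longrightarrow>
      ul \<ge> ur \<longrightarrow>
      0 < \<alpha> \<longrightarrow> \<alpha> \<le> M \<longrightarrow>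
      (\<forall>x \<in> convex hull {um, up, ul, ur}. \<alpha> \<le> deriv (deriv f) x \<and> deriv (deriv f) x \<le> M) \<longrightarrow>
      dissipation_rate f um up ul ur
        \<le> C1 * (M ^ 3 / \<alpha> ^ 3) * max (entropy_cost f um up) 0
          - C2 * \<alpha> * (ul - ur) * ((ul - um)\<^sup>2 + (ur - up)\<^sup>2))"
proof (rule exI[of _ 3], rule exI[of _ "1 / 48"], intro conjI allI impI)
  fix f :: "real \<Rightarrow> real" and \<alpha>\<^sub>0 ul ur um up \<alpha> M :: real
  assume f: "\<forall>x. f differentiable (at x)" "\<forall>x. deriv f differentiable (at x)"
    and "ur \<le> ul" "0 < \<alpha>" "\<alpha> \<le> M"
    and curvature: "\<forall>x \<in> convex hull {um, up, ul, ur}.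
      \<alpha> \<le> deriv (deriv f) x \<and> deriv (deriv f) x \<le> M"
  define E where "E = max (entropy_cost f um up) 0"
  have "dissipation_rate f um up ul ur
      \<le> 3 * E - 1 / 48 * \<alpha> * (ul - ur) * ((ul - um)\<^sup>2 + (ur - up)\<^sup>2)"
    unfolding E_def
  proof (rule dissipation_rate_le[where K = "convex hull {um, up, ul, ur}"])
    show "is_interval (convex hull {um, up, ul, ur})"
      by (simp add: is_interval_convex_1)
  qed (use f curvature \<open>0 < \<alpha>\<close> \<open>ur \<le> ul\<close> in \<open>auto intro: hull_inc\<close>)
  moreover have "1 * E \<le> M ^ 3 / \<alpha> ^ 3 * E"
  proof (rule mult_right_mono)
    show "1 \<le> M ^ 3 / \<alpha> ^ 3"
      using \<open>0 < \<alpha>\<close> \<open>\<alpha> \<le> M\<close> by (simp add: power_mono)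
  qed (simp add: E_def)
  ultimately show "dissipation_rate f um up ul ur
      \<le> 3 * (M ^ 3 / \<alpha> ^ 3) * max (entropy_cost f um up) 0
        - 1 / 48 * \<alpha> * (ul - ur) * ((ul - um)\<^sup>2 + (ur - up)\<^sup>2)"
    unfolding E_def[symmetric] by (simp add: algebra_simps)
qed simp_all

end
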